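(* Let $\Gamma$ be a countable group. Every amenable invariant random equivalence relation on $\Gamma$ is a weak limit of a sequence of finite invariant random equivalence relations on $\Gamma$.
   Context: Let $\Gamma$ be a countable discrete group. $\operatorname{Prob}(\Gamma)$ is the set of probability measures on $\Gamma$ with the topology (and Borel structure) inherited from $\ell^1(\Gamma)$; $\Gamma$ acts on it by $(g.\eta)(h)=\eta(g^{-1}h)$. $\mathcal E$ is the set of equivalence relations on $\Gamma$, with the topology inherited from $\{0,1\}^{\Gamma\times\Gamma}$ (a compact metrizable space). $\Gamma$ acts on $\mathcal E$ by left shift: $(h,h')\in g.r$ iff $(g^{-1}h,g^{-1}h')\in r$. For $r\in\mathcal E$, $[g]_r$ is the $r$-class of $g$; $e$ is the identity. An invariant random equivalence relation (IRE) on $\Gamma$ is a $\Gamma$-invariant Borel probability measure on $\mathcal E$. An IRE $\rho$ is finite if $\rho$-almost every $r$ has only finite classes. An IRE $\rho$ is amenable if there are Borel maps $\lambda_n\colon\mathcal E\to\operatorname{Prob}(\Gamma)$, $r\mapsto\lambda_n^r$ ($n\in\mathbb N$), such that for $\rho$-almost every $r\in\mathcal E$ and every $g\in[e]_r$, $\|g^{-1}.\lambda_n^r-\lambda_n^{g^{-1}.r}\|_1\to0$ as $n\to\infty$. Weak limits are taken in the weak topology on $\operatorname{Prob}(\mathcal E)$ (testing against continuous functions on $\mathcal E$). *)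

theory Defs
  imports "HOL-Probability.Probability"
begin

text \<open>
  The countable discrete group \<open>\<Gamma>\<close> is a type of class \<open>{group_add, countable}\<close>.
  The class \<open>group_add\<close> does not assume commutativity: the product \<open>g h\<close> is written \<open>g + h\<close>,
  the inverse of \<open>g\<close> is \<open>- g\<close>, and the identity \<open>e\<close> is \<open>0\<close>.
\<close>

text \<open>\<open>Prob(\<Gamma>)\<close> is the type \<open>'g pmf\<close>; the measure \<open>\<eta>\<close> corresponds to the function \<open>pmf \<eta>\<close>
  in \<open>\<ell>\<^sup>1(\<Gamma>)\<close>.\<close>

definition l1_dist :: "'g pmf \<Rightarrow> 'g pmf \<Rightarrow> real"
  where "l1_dist p q = (\<Sum>\<^sub>\<infinity>g. \<bar>pmf p g - pmf q g\<bar>)"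

lemma pmf_abs_diff_summable: "(\<lambda>g. \<bar>pmf p g - pmf q g\<bar>) summable_on A"
proof -
  have s: "pmf r summable_on A" for r :: "'a pmf"
  proof (rule nonneg_bdd_above_summable_on)
    have "sum (pmf r) F \<le> 1" if "finite F" for F
      using that by (metis measure_measure_pmf_finite measure_pmf.prob_le_1)
    then show "bdd_above (sum (pmf r) ` {F. F \<subseteq> A \<and> finite F})"
      by (auto intro!: bdd_aboveI2[where M = 1])
  qed simp
  show ?thesis
  proof (rule summable_on_comparison_test[OF summable_on_add[OF s[of p] s[of q]]])
    show "\<bar>pmf p g - pmf q g\<bar> \<le> pmf p g + pmf q g" for g
      using pmf_nonneg[of p g] pmf_nonneg[of q g] by linarith
  qed simp
qed

lemma Metric_space_l1_dist: "Metric_space UNIV l1_dist"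
proof
  show "0 \<le> l1_dist p q" for p q :: "'a pmf"
    unfolding l1_dist_def by (rule infsum_nonneg) simp
  show "l1_dist p q = l1_dist q p" for p q :: "'a pmf"
    by (simp add: l1_dist_def abs_minus_commute)
  show "l1_dist p q = 0 \<longleftrightarrow> p = q" for p q :: "'a pmf"
  proof
    assume "l1_dist p q = 0"
    then have "\<bar>pmf p g - pmf q g\<bar> = 0" for g
      unfolding l1_dist_def
      using nonneg_infsum_le_0D[of "\<lambda>g. \<bar>pmf p g - pmf q g\<bar>" UNIV g] pmf_abs_diff_summable
      by fastforce
    then show "p = q" by (intro pmf_eqI) simp
  qed (simp add: l1_dist_def)
  show "l1_dist p r \<le> l1_dist p q + l1_dist q r" for p q r :: "'a pmf"
    unfolding l1_dist_def
    unfolding infsum_add[OF pmf_abs_diff_summable pmf_abs_diff_summable, symmetric]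
    by (rule infsum_mono[OF pmf_abs_diff_summable
          summable_on_add[OF pmf_abs_diff_summable pmf_abs_diff_summable]]) linarith
qed

text \<open>\<open>Prob(\<Gamma>)\<close> with the Borel \<open>\<sigma>\<close>-algebra of the \<open>\<ell>\<^sup>1\<close>-topology.\<close>

definition Prob_borel :: "'g pmf measure"
  where "Prob_borel = sigma UNIV {U. openin (Metric_space.mtopology UNIV l1_dist) U}"

definition translate_pmf :: "'g::group_add \<Rightarrow> 'g pmf \<Rightarrow> 'g pmf"
  where "translate_pmf g \<eta> = map_pmf ((+) g) \<eta>"

lemma pmf_translate_pmf: "pmf (translate_pmf g \<eta>) h = pmf \<eta> (- g + h)"
proof -
  have "pmf (map_pmf ((+) g) \<eta>) (g + (- g + h)) = pmf \<eta> (- g + h)"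
    by (rule pmf_map_inj') (simp add: inj_def)
  then show ?thesis
    by (simp add: translate_pmf_def add.assoc[symmetric])
qed

text \<open>Relations are their indicator functions, elements of \<open>{0,1}\<^bsup>\<Gamma>\<times>\<Gamma>\<^esup>\<close>; the type
  \<open>'g \<times> 'g \<Rightarrow> bool\<close> carries the product topology, with \<open>bool\<close> discrete.\<close>

definition equiv_rels :: "('g \<times> 'g \<Rightarrow> bool) set"
  where "equiv_rels = {r. equiv UNIV (Collect r)}"

definition Rel_borel :: "('g \<times> 'g \<Rightarrow> bool) measure"
  where "Rel_borel = restrict_space borel equiv_rels"

definition shift_rel :: "'g::group_add \<Rightarrow> ('g \<times> 'g \<Rightarrow> bool) \<Rightarrow> 'g \<times> 'g \<Rightarrow> bool"
  where "shift_rel g r = (\<lambda>(h, h'). r (- g + h, - g + h'))"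

definition rel_class :: "('g \<times> 'g \<Rightarrow> bool) \<Rightarrow> 'g \<Rightarrow> 'g set"
  where "rel_class r g = Collect r `` {g}"

lemma shift_rel_equiv_rels: "r \<in> equiv_rels \<Longrightarrow> shift_rel g r \<in> equiv_rels"
  unfolding equiv_rels_def shift_rel_def equiv_def refl_on_def sym_def trans_def
    mem_Collect_eq case_prod_conv
  by blast

lemma measurable_shift_rel [measurable]: "shift_rel g \<in> measurable Rel_borel Rel_borel"
proof -
  have "continuous_on UNIV (shift_rel g)"
    unfolding shift_rel_def case_prod_unfold
    by (intro continuous_on_coordinatewise_then_product continuous_on_product_coordinates)
  then have "shift_rel g \<in> measurable borel borel"
    by (rule borel_measurable_continuous_onI)
  then show ?thesis
    unfolding Rel_borel_def
    by (intro measurable_restrict_space3) (auto simp: shift_rel_equiv_rels)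
qed

definition IRE :: "('g::{group_add,countable} \<times> 'g \<Rightarrow> bool) measure \<Rightarrow> bool"
  where "IRE \<rho> \<longleftrightarrow> prob_space \<rho> \<and> sets \<rho> = sets Rel_borel \<and> (\<forall>g. distr \<rho> \<rho> (shift_rel g) = \<rho>)"

definition finite_IRE :: "('g::{group_add,countable} \<times> 'g \<Rightarrow> bool) measure \<Rightarrow> bool"
  where "finite_IRE \<rho> \<longleftrightarrow> IRE \<rho> \<and> (AE r in \<rho>. \<forall>g. finite (rel_class r g))"

definition amenable_IRE :: "('g::{group_add,countable} \<times> 'g \<Rightarrow> bool) measure \<Rightarrow> bool"
  where "amenable_IRE \<rho> \<longleftrightarrow> IRE \<rho> \<and>
    (\<exists>\<mu> :: nat \<Rightarrow> ('g \<times> 'g \<Rightarrow> bool) \<Rightarrow> 'g pmf.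
      (\<forall>n. \<mu> n \<in> measurable Rel_borel Prob_borel) \<and>
      (AE r in \<rho>. \<forall>g\<in>rel_class r 0.
        (\<lambda>n. l1_dist (translate_pmf (- g) (\<mu> n r)) (\<mu> n (shift_rel (- g) r))) \<longlonglongrightarrow> 0))"

text \<open>No boundedness of the test functions is required, as \<open>equiv_rels\<close> is compact.\<close>

definition weak_limit :: "(nat \<Rightarrow> ('g \<times> 'g \<Rightarrow> bool) measure) \<Rightarrow> ('g \<times> 'g \<Rightarrow> bool) measure \<Rightarrow> bool"
  where "weak_limit \<rho>s \<rho> \<longleftrightarrow>
    (\<forall>f :: ('g \<times> 'g \<Rightarrow> bool) \<Rightarrow> real. continuous_on equiv_rels f \<longrightarrow>
      (\<lambda>n. \<integral>r. f r \<partial>\<rho>s n) \<longlonglongrightarrow> (\<integral>r. f r \<partial>\<rho>))"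

end

(* The proof avoids hyperfiniteness. Given Reiter functions mu, every v carries the probability
   measure m_v(r) = v.mu(v^-1.r) on the group, and m_v, m_w are l1-close when v ~_r w. Shared i.i.d.
   uniform noise lets every v sample a centre c(v) from m_v equivariantly, so that c(v) = c(w) with
   high probability whenever m_v and m_w are close. Declare v and w equivalent iff v ~_r w and
   c(v) = c(w). This is again invariant; its classes are finite because the fibres of c have
   expected size one by mass transport; and as mu becomes more invariant, the new relation agrees
   with r on any given pair with probability tending to one. *)
theory Submission
  imports Defs
begin

section \<open>Preliminaries\<close>

text \<open>Sharing the noise turns closeness of measures into equality of points: all vertices
  compare the same number \<open>x u\<close> with their own threshold at u, so two markings differ
  at u only if \<open>x u\<close> falls between the two thresholds. One round may mark no point or
  several, hence the infinite sequence of rounds. A round fails with probability at most 3/4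
  whatever the measure is, so a related pair is separated with probability at most (3/4)^N + N d,
  where d is the l1-distance of its two measures; N is fixed first, and the Reiter index goes to
  infinity afterwards. The Reiter measures live on the whole group, so a centre may lie outside the
  class of its vertex and different classes may share a centre. This is why the new relation is
  intersected with r, and why finiteness comes from counting all group elements with a given centre.
  The convergence in the hypothesis is anchored at the identity; invariance of the law moves it to
  every base vertex. Compactness of the space of relations reduces weak convergence to finitely many
  pairs at a time.\<close>

lemma emeasure_UN_le_nn_integral:
  assumes "countable I" and X[measurable]: "\<And>i. i \<in> I \<Longrightarrow> X i \<in> sets M"
  shows "emeasure M (\<Union>i\<in>I. X i) \<le> (\<integral>\<^sup>+i. emeasure M (X i) \<partial>count_space I)"
proof -
  have [measurable]: "(\<Union>i\<in>I. X i) \<in> sets M"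
    using assms by (intro sets.countable_UN') auto
  have "emeasure M (\<Union>i\<in>I. X i) = (\<integral>\<^sup>+x. indicator (\<Union>i\<in>I. X i) x \<partial>M)"
    by simp
  also have "\<dots> \<le> (\<integral>\<^sup>+x. (\<integral>\<^sup>+i. indicator (X i) x \<partial>count_space I) \<partial>M)"
  proof (rule nn_integral_mono)
    fix x
    show "indicator (\<Union>i\<in>I. X i) x \<le> (\<integral>\<^sup>+i. (indicator (X i) x :: ennreal) \<partial>count_space I)"
    proof (cases "x \<in> (\<Union>i\<in>I. X i)")
      case True
      then obtain i where "i \<in> I" "x \<in> X i" by auto
      then show ?thesis
        using nn_integral_ge_point[of i I "\<lambda>i. indicator (X i) x"] True by simp
    qed simp
  qed
  also have "\<dots> = (\<integral>\<^sup>+i. (\<integral>\<^sup>+x. indicator (X i) x \<partial>M) \<partial>count_space I)"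
    by (rule nn_integral_count_space_nn_integral[OF \<open>countable I\<close>]) simp
  also have "\<dots> = (\<integral>\<^sup>+i. emeasure M (X i) \<partial>count_space I)"
    by (intro nn_integral_cong) simp
  finally show ?thesis .
qed

lemma nn_integral_abs_diff_pmf:
  "(\<integral>\<^sup>+u. ennreal \<bar>pmf p u - pmf q u\<bar> \<partial>count_space UNIV) = ennreal (l1_dist p q)"
proof -
  have "Infinite_Set_Sum.abs_summable_on (\<lambda>u. \<bar>pmf p u - pmf q u\<bar>) UNIV"
    using pmf_abs_diff_summable[of p q UNIV]
    by (simp flip: abs_summable_equivalent)
  then show ?thesis
    by (simp add: nn_integral_conv_infsetsum l1_dist_def infsetsum_infsum)
qed

lemma l1_dist_translate: "l1_dist (translate_pmf g p) (translate_pmf g q) = l1_dist p q"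
  unfolding l1_dist_def pmf_translate_pmf
  by (rule infsum_reindex_bij_witness[of _ "\<lambda>h. g + h" "\<lambda>h. - g + h"])
     (simp_all add: add.assoc[symmetric])

lemma translate_translate_pmf: "translate_pmf g (translate_pmf h p) = translate_pmf (g + h) p"
  by (simp add: translate_pmf_def pmf.map_comp o_def add.assoc fun_eq_iff cong: map_pmf_cong)

lemma shift_shift_rel: "shift_rel g (shift_rel h r) = shift_rel (g + h) r"
  by (simp add: shift_rel_def minus_add add.assoc[symmetric] diff_conv_add_uminus
      del: add_uminus_conv_diff)

text \<open>Over a countable index set, Borel measurability into a product of second countable
  spaces can be tested on coordinates. This is how maps into \<open>Rel_borel\<close> are handled,
  one pair at a time.\<close>

instance bool :: second_countable_topology
proof
  show "\<exists>B::bool set set. countable B \<and> open = generate_topology B"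
    by (intro exI[of _ "range lessThan \<union> range greaterThan"] conjI)
      (auto simp: open_bool_def intro: countable_finite)
qed

text \<open>Evaluation at a point is 1-Lipschitz for \<open>l1_dist\<close>, so its strict sublevel
  sets are open. Borel maps into \<open>Prob_borel\<close> are used below through these
  coordinates.\<close>

lemma measurable_pmf_eval [measurable]: "(\<lambda>p. pmf p g) \<in> borel_measurable Prob_borel"
proof (rule borel_measurableI_less)
  fix a
  have "openin (Metric_space.mtopology UNIV l1_dist) {p. pmf p g < a}"
    unfolding Metric_space.openin_mtopology[OF Metric_space_l1_dist]
  proof (intro conjI allI impI)
    fix p assume p: "p \<in> {p. pmf p g < a}"
    have "q \<in> {p. pmf p g < a}" if "l1_dist p q < a - pmf p g" for q
    proof -
      have "\<bar>pmf p g - pmf q g\<bar> \<le> l1_dist p q"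
        using finite_sum_le_infsum[OF pmf_abs_diff_summable[of p q UNIV], of "{g}"]
        by (simp add: l1_dist_def)
      with that show ?thesis by auto
    qed
    then show "\<exists>r>0. Metric_space.mball UNIV l1_dist p r \<subseteq> {p. pmf p g < a}"
      using p by (intro exI[of _ "a - pmf p g"]) (auto simp: Metric_space.in_mball[OF Metric_space_l1_dist])
  qed simp
  then show "{p \<in> space Prob_borel. pmf p g < a} \<in> sets Prob_borel"
    by (auto simp: Prob_borel_def)
qed

lemma space_Rel_borel: "space Rel_borel = equiv_rels"
  by (simp add: Rel_borel_def space_restrict_space)

lemma measurable_Rel_borel_eval [measurable]: "Measurable.pred Rel_borel (\<lambda>r. r p)"
proof -
  have "(\<lambda>r :: 'a \<times> 'a \<Rightarrow> bool. r p) \<in> borel_measurable borel"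
    by (intro borel_measurable_continuous_onI continuous_on_product_coordinates)
  then have "Measurable.pred borel (\<lambda>r :: 'a \<times> 'a \<Rightarrow> bool. r p)"
    by (simp add: measurable_cong_sets[OF refl sets_borel_eq_count_space])
  then show ?thesis
    unfolding Rel_borel_def by (rule measurable_restrict_space1)
qed

lemma measurable_into_Rel_borel:
  fixes c :: "'a \<Rightarrow> 'g::countable \<times> 'g \<Rightarrow> bool"
  assumes "\<And>p. Measurable.pred M (\<lambda>x. c x p)" "\<And>x. x \<in> space M \<Longrightarrow> c x \<in> equiv_rels"
  shows "c \<in> measurable M Rel_borel"
  unfolding Rel_borel_def
proof (rule measurable_restrict_space2)
  show "c \<in> borel_measurable M"
    by (rule measurable_coordinatewise_then_product, rule measurable_compose[OF assms(1)]) simp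
qed (use assms(2) in auto)

section \<open>The topology of the space of equivalence relations\<close>

lemma equiv_rels_iff:
  "r \<in> equiv_rels \<longleftrightarrow> (\<forall>x. r (x, x)) \<and> (\<forall>x y. r (x, y) \<longrightarrow> r (y, x)) \<and>
    (\<forall>x y z. r (x, y) \<longrightarrow> r (y, z) \<longrightarrow> r (x, z))"
  by (simp add: equiv_rels_def equiv_def refl_on_def sym_def trans_def)

lemma closed_equiv_rels: "closed (equiv_rels :: ('g \<times> 'g \<Rightarrow> bool) set)"
proof -
  \<comment> \<open>Both properties are used: an implication defines a closed set when its premise
    is open and its conclusion is closed.\<close>
  have eval: "open {r :: 'g \<times> 'g \<Rightarrow> bool. r p}" "closed {r :: 'g \<times> 'g \<Rightarrow> bool. r p}" for p
  proof -
    have "open ((\<lambda>r :: 'g \<times> 'g \<Rightarrow> bool. r p) -` {True})"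
      by (rule open_vimage[OF Topological_Spaces.open_discrete continuous_on_product_coordinates])
    moreover have "closed ((\<lambda>r :: 'g \<times> 'g \<Rightarrow> bool. r p) -` {True})"
      by (rule closed_vimage[OF _ continuous_on_product_coordinates]) simp
    ultimately show "open {r :: 'g \<times> 'g \<Rightarrow> bool. r p}" "closed {r :: 'g \<times> 'g \<Rightarrow> bool. r p}"
      by (simp_all add: vimage_def)
  qed
  have "equiv_rels = {r :: 'g \<times> 'g \<Rightarrow> bool. (\<forall>x. r (x, x)) \<and> (\<forall>x y. r (x, y) \<longrightarrow> r (y, x)) \<and>
      (\<forall>x y z. r (x, y) \<longrightarrow> r (y, z) \<longrightarrow> r (x, z))}"
    by (simp only: set_eq_iff mem_Collect_eq equiv_rels_iff simp_thms)
  also have "closed \<dots>"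
    by (intro closed_Collect_conj closed_Collect_all closed_Collect_imp eval)
  finally show ?thesis .
qed

lemma compact_equiv_rels: "compact (equiv_rels :: ('g \<times> 'g \<Rightarrow> bool) set)"
proof -
  have "compact (UNIV :: bool set)" by (simp add: finite_imp_compact)
  then have "compactin (product_topology (\<lambda>_. euclidean) UNIV) (PiE UNIV (\<lambda>_ :: 'g \<times> 'g. UNIV :: bool set))"
    by (subst compactin_PiE) simp
  then have "compact (UNIV :: ('g \<times> 'g \<Rightarrow> bool) set)"
    by (simp add: euclidean_product_topology PiE_UNIV_domain)
  then show ?thesis
    using closed_equiv_rels compact_Int_closed by fastforce
qed

lemma open_cylinder: "finite F \<Longrightarrow> open {s :: 'a \<Rightarrow> bool. \<forall>p\<in>F. s p = r p}"
proof -
  have "open ((\<lambda>s :: 'a \<Rightarrow> bool. s p) -` {r p})" for p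
    by (rule open_vimage[OF Topological_Spaces.open_discrete continuous_on_product_coordinates])
  then have "open {s :: 'a \<Rightarrow> bool. s p = r p}" for p
    by (simp add: vimage_def)
  moreover assume "finite F"
  ultimately show ?thesis
    by (simp add: Collect_ball_eq open_INT)
qed

lemma open_contains_cylinder:
  fixes U :: "('a \<Rightarrow> bool) set"
  assumes "open U" "r \<in> U"
  obtains F where "finite F" "{s. \<forall>p\<in>F. s p = r p} \<subseteq> U"
proof -
  obtain X where X: "r \<in> PiE UNIV X" "finite {i. X i \<noteq> UNIV}" "PiE UNIV X \<subseteq> U"
    using product_topology_open_contains_basis[of "\<lambda>_. euclidean" UNIV U r] assms
    by (auto simp: open_fun_def)
  show thesis
  proof (rule that[OF X(2)], intro subsetI)
    fix s assume "s \<in> {s. \<forall>p\<in>{i. X i \<noteq> UNIV}. s p = r p}"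
    then have "s i \<in> X i" for i
      using X(1) by (cases "X i = UNIV") (auto simp: PiE_iff)
    then have "s \<in> PiE UNIV X" by (simp add: PiE_iff)
    then show "s \<in> U" using X(3) by auto
  qed
qed

text \<open>Uniform continuity on a compact space, with cylinders as neighbourhoods. Finitely many
  cylinders cover the space, and F collects their coordinates; then r and s lie in a common cylinder
  and both values are within e/2 of the value at its base point.\<close>

lemma continuous_on_equiv_rels_depends_finitely:
  fixes f :: "('g \<times> 'g \<Rightarrow> bool) \<Rightarrow> real"
  assumes f: "continuous_on equiv_rels f" and "0 < e"
  obtains F where "finite F"
    "\<And>r s. r \<in> equiv_rels \<Longrightarrow> s \<in> equiv_rels \<Longrightarrow> (\<forall>p\<in>F. s p = r p) \<Longrightarrow> \<bar>f s - f r\<bar> < e"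
proof -
  have "\<exists>F. finite F \<and> (\<forall>s\<in>equiv_rels. (\<forall>p\<in>F. s p = r p) \<longrightarrow> \<bar>f s - f r\<bar> < e/2)"
    if r: "r \<in> equiv_rels" for r
  proof -
    have "f r \<in> ball (f r) (e/2)" using \<open>0 < e\<close> by simp
    from f[unfolded continuous_on_topological, rule_format, OF r open_ball this]
    obtain U where U: "open U" "r \<in> U" "\<And>s. s \<in> equiv_rels \<Longrightarrow> s \<in> U \<Longrightarrow> f s \<in> ball (f r) (e/2)"
      by blast
    obtain F where F: "finite F" "{s. \<forall>p\<in>F. s p = r p} \<subseteq> U"
      using open_contains_cylinder[OF U(1,2)] .
    then have "\<forall>s\<in>equiv_rels. (\<forall>p\<in>F. s p = r p) \<longrightarrow> \<bar>f s - f r\<bar> < e/2"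
      using U(3) by (simp add: dist_real_def abs_minus_commute subset_iff)
    with F(1) show ?thesis by auto
  qed
  then obtain G where G: "\<And>r. r \<in> equiv_rels \<Longrightarrow> finite (G r)"
    "\<And>r s. r \<in> equiv_rels \<Longrightarrow> s \<in> equiv_rels \<Longrightarrow> (\<forall>p\<in>G r. s p = r p) \<Longrightarrow> \<bar>f s - f r\<bar> < e/2"
    by metis
  obtain C where C: "C \<subseteq> equiv_rels" "finite C" "equiv_rels \<subseteq> (\<Union>r\<in>C. {s. \<forall>p\<in>G r. s p = r p})"
    by (rule compactE_image[OF compact_equiv_rels, of equiv_rels "\<lambda>r. {s. \<forall>p\<in>G r. s p = r p}"])
      (use G(1) open_cylinder in auto)
  show thesis
  proof (rule that[of "\<Union>r\<in>C. G r"])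
    show "finite (\<Union>r\<in>C. G r)" using C G(1) by auto
    fix r s :: "'g \<times> 'g \<Rightarrow> bool" assume rs: "r \<in> equiv_rels" "s \<in> equiv_rels" "\<forall>p\<in>(\<Union>r\<in>C. G r). s p = r p"
    then obtain t where t: "t \<in> C" "\<forall>p\<in>G t. r p = t p" using C(3) by auto
    then have "\<bar>f r - f t\<bar> < e/2" "\<bar>f s - f t\<bar> < e/2"
      using G(2)[of t] rs C(1) by auto
    then show "\<bar>f s - f r\<bar> < e" by linarith
  qed
qed

section \<open>Equivariant sampling from shared noise\<close>

definition noise :: "('g \<Rightarrow> real) measure"
  where "noise = PiM UNIV (\<lambda>_. uniform_measure lborel {0..1})"

definition noises :: "(nat \<Rightarrow> 'g \<Rightarrow> real) measure"
  where "noises = PiM UNIV (\<lambda>_. noise)"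

text \<open>The factor 2 makes the expected number of marked points \<open>1/2\<close>, so that exactly one point is
  marked with probability at least \<open>1/4\<close>. The centre is read off the first round in which this
  happens.\<close>

definition marked :: "'g pmf \<Rightarrow> ('g \<Rightarrow> real) \<Rightarrow> 'g set"
  where "marked p x = {u. x u \<le> pmf p u / 2}"

lemma prob_space_uniform: "prob_space (uniform_measure lborel {0..1::real})"
  by (rule prob_space_uniform_measure) auto

lemma prob_space_noise: "prob_space noise"
  unfolding noise_def by (intro prob_space_PiM prob_space_uniform)

lemma prob_space_noises: "prob_space noises"
  unfolding noises_def by (intro prob_space_PiM prob_space_noise)

lemma space_noise [simp]: "space noise = UNIV"
  by (simp add: noise_def space_PiM)

lemma space_noises [simp]: "space noises = UNIV"
  by (simp add: noises_def space_PiM)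

lemma measurable_noise_eval [measurable]: "(\<lambda>x. x u) \<in> borel_measurable noise"
proof -
  have "(\<lambda>x. x u) \<in> measurable noise (uniform_measure lborel {0..1::real})"
    unfolding noise_def by measurable
  then show ?thesis by (simp add: measurable_def)
qed

lemma measurable_noises_eval [measurable]: "(\<lambda>x. x i) \<in> measurable noises noise"
  unfolding noises_def by measurable

lemma emeasure_noise_box:
  fixes J :: "'g set"
  assumes "finite J" "\<And>i. i \<in> J \<Longrightarrow> B i \<in> sets borel"
  shows "emeasure noise {x. \<forall>i\<in>J. x i \<in> B i} = (\<Prod>i\<in>J. emeasure (uniform_measure lborel {0..1}) (B i))"
proof -
  have "{x. \<forall>i\<in>J. x i \<in> B i} = prod_emb UNIV (\<lambda>_::'g. uniform_measure lborel {0..1}) J (Pi\<^sub>E J B)"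
    by (auto simp: prod_emb_def PiE_iff)
  then show ?thesis
    unfolding noise_def using assms
    by (simp add: emeasure_PiM_emb prob_space_uniform)
qed

lemma emeasure_noises_box:
  assumes "finite J" "\<And>i. i \<in> J \<Longrightarrow> B i \<in> sets noise"
  shows "emeasure noises {x. \<forall>i\<in>J. x i \<in> B i} = (\<Prod>i\<in>J. emeasure noise (B i))"
proof -
  have "{x. \<forall>i\<in>J. x i \<in> B i} = prod_emb UNIV (\<lambda>_::nat. noise) J (Pi\<^sub>E J B)"
    by (auto simp: prod_emb_def PiE_iff)
  then show ?thesis
    unfolding noises_def using assms
    by (simp add: emeasure_PiM_emb prob_space_noise)
qed

section \<open>Probabilities in a single round of noise\<close>

lemma emeasure_uniform_atMost:
  assumes "0 \<le> a" "a \<le> 1"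
  shows "emeasure (uniform_measure lborel {0..1}) {..a} = ennreal a"
proof -
  have "{0..1} \<inter> {..a} = {0..a}" using assms by auto
  then show ?thesis using assms by (simp add: divide_ennreal_def)
qed

lemma emeasure_uniform_Ioc:
  assumes "0 \<le> a" "b \<le> 1"
  shows "emeasure (uniform_measure lborel {0..1}) {a<..b} = ennreal (b - a)"
proof -
  have "{0..1} \<inter> {a<..b} = {a<..b}" using assms by auto
  then show ?thesis using assms by (cases "a \<le> b") (auto simp: divide_ennreal_def ennreal_neg)
qed

lemma sets_marked_eq [measurable]:
  fixes p :: "'g::countable pmf"
  shows "{x. marked p x = S} \<in> sets noise" "{x. marked p x = marked q x} \<in> sets noise"
proof -
  have "{x \<in> space noise. \<forall>u. x u \<le> pmf p u / 2 \<longleftrightarrow> u \<in> S} \<in> sets noise"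
    by measurable
  then show "{x. marked p x = S} \<in> sets noise"
    by (simp add: marked_def set_eq_iff)
  have "{x \<in> space noise. \<forall>u. x u \<le> pmf p u / 2 \<longleftrightarrow> x u \<le> pmf q u / 2} \<in> sets noise"
    by measurable
  then show "{x. marked p x = marked q x} \<in> sets noise"
    by (simp add: marked_def set_eq_iff)
qed

text \<open>Union bound over u: the markings differ at u only if \<open>x u\<close> falls between
  the two thresholds, an interval of length half of the difference of the two masses at u. The bound
  gives away this factor 1/2.\<close>

lemma emeasure_marked_neq:
  fixes p q :: "'g::countable pmf"
  shows "emeasure noise {x. marked p x \<noteq> marked q x} \<le> ennreal (l1_dist p q)"
proof -
  let ?U = "uniform_measure lborel {0..1::real}"
  define B where "B u = {x \<in> space noise. pmf q u / 2 < x u \<and> x u \<le> pmf p u / 2 \<or>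
     pmf p u / 2 < x u \<and> x u \<le> pmf q u / 2}" for u
  have [measurable]: "B u \<in> sets noise" for u unfolding B_def by measurable
  have le: "emeasure noise (B u) \<le> ennreal \<bar>pmf p u - pmf q u\<bar>" for u
  proof -
    have h: "pmf p' u / 2 \<le> 1" for p' :: "'g pmf" using pmf_le_1[of p' u] by linarith
    have "emeasure noise (B u) = emeasure noise ({x. \<forall>i\<in>{u}. x i \<in> {pmf q u / 2<..pmf p u / 2}} \<union>
        {x. \<forall>i\<in>{u}. x i \<in> {pmf p u / 2<..pmf q u / 2}})"
      by (rule arg_cong[of _ _ "emeasure noise"]) (auto simp: B_def)
    also have "\<dots> \<le> emeasure noise {x. \<forall>i\<in>{u}. x i \<in> {pmf q u / 2<..pmf p u / 2}} +
        emeasure noise {x. \<forall>i\<in>{u}. x i \<in> {pmf p u / 2<..pmf q u / 2}}"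
    proof (rule emeasure_subadditive)
      have "{x \<in> space noise. x u \<in> {a<..b}} \<in> sets noise" for a b by measurable
      from this[of "pmf q u / 2" "pmf p u / 2"] this[of "pmf p u / 2" "pmf q u / 2"]
      show "{x. \<forall>i\<in>{u}. x i \<in> {pmf q u / 2<..pmf p u / 2}} \<in> sets noise"
        "{x. \<forall>i\<in>{u}. x i \<in> {pmf p u / 2<..pmf q u / 2}} \<in> sets noise" by simp_all
    qed
    also have "\<dots> = ennreal (pmf p u / 2 - pmf q u / 2) + ennreal (pmf q u / 2 - pmf p u / 2)"
      using h emeasure_noise_box[of "{u}" "\<lambda>_. {pmf q u / 2<..pmf p u / 2}"]
        emeasure_noise_box[of "{u}" "\<lambda>_. {pmf p u / 2<..pmf q u / 2}"]
      by (simp add: emeasure_uniform_Ioc del: greaterThanAtMost_iff emeasure_uniform_measure)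
    also have "\<dots> \<le> ennreal \<bar>pmf p u - pmf q u\<bar>"
      by (cases "pmf p u \<le> pmf q u") (auto simp: ennreal_neg intro!: ennreal_leI)
    finally show ?thesis .
  qed
  have "{x. marked p x \<noteq> marked q x} = (\<Union>u\<in>UNIV. B u)"
    by (auto simp: marked_def B_def not_le set_eq_iff simp flip: not_le)
  then have "emeasure noise {x. marked p x \<noteq> marked q x} \<le> (\<integral>\<^sup>+u. emeasure noise (B u) \<partial>count_space UNIV)"
    using emeasure_UN_le_nn_integral[of UNIV B noise] by simp
  also have "\<dots> \<le> (\<integral>\<^sup>+u. ennreal \<bar>pmf p u - pmf q u\<bar> \<partial>count_space UNIV)"
    by (intro nn_integral_mono le)
  finally show ?thesis by (simp add: nn_integral_abs_diff_pmf)
qed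

text \<open>Bonferroni: the probability that u alone is marked is at least that of u being marked,
  \<open>pmf p u / 2\<close>, minus the sum over other z of the probability that both are marked,
  which by independence is at most \<open>pmf p u / 4\<close>. The events for different u are
  disjoint, so the bounds add up to 1/4.\<close>

lemma emeasure_marked_singleton:
  fixes p :: "'g::countable pmf"
  shows "emeasure noise {x. \<exists>u. marked p x = {u}} \<ge> ennreal (1/4)"
proof -
  define B where "B u = {x \<in> space noise. x u \<le> pmf p u / 2}" for u
  have [measurable]: "B u \<in> sets noise" for u unfolding B_def by measurable
  have h: "pmf p u / 2 \<le> 1" for u using pmf_le_1[of p u] by linarith
  have B1: "emeasure noise (B u) = ennreal (pmf p u / 2)" for u
    using emeasure_noise_box[of "{u}" "\<lambda>u. {..pmf p u / 2}"] h
    by (simp add: B_def emeasure_uniform_atMost del: emeasure_uniform_measure)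
  have B2: "emeasure noise (B u \<inter> B z) = ennreal (pmf p u * pmf p z / 4)" if "u \<noteq> z" for u z
  proof -
    have "B u \<inter> B z = {x. \<forall>i\<in>{u,z}. x i \<in> {..pmf p i / 2}}"
      by (auto simp: B_def)
    then show ?thesis
      using that h emeasure_noise_box[of "{u,z}" "\<lambda>u. {..pmf p u / 2}"]
      by (simp add: emeasure_uniform_atMost ennreal_mult'[symmetric] del: emeasure_uniform_measure)
  qed
  have one: "emeasure noise {x. marked p x = {u}} \<ge> ennreal (pmf p u / 4)" for u
  proof -
    have "B u \<subseteq> {x. marked p x = {u}} \<union> (\<Union>z\<in>-{u}. B u \<inter> B z)"
      by (auto simp: B_def marked_def)
    then have "emeasure noise (B u) \<le> emeasure noise ({x. marked p x = {u}} \<union> (\<Union>z\<in>-{u}. B u \<inter> B z))"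
      by (intro emeasure_mono) (auto intro!: sets.Un sets.countable_UN' sets_marked_eq)
    also have "\<dots> \<le> emeasure noise {x. marked p x = {u}} + emeasure noise (\<Union>z\<in>-{u}. B u \<inter> B z)"
      by (intro emeasure_subadditive) (auto intro!: sets.countable_UN' sets_marked_eq)
    also have "emeasure noise (\<Union>z\<in>-{u}. B u \<inter> B z) \<le> (\<integral>\<^sup>+z. emeasure noise (B u \<inter> B z) \<partial>count_space (-{u}))"
      by (rule emeasure_UN_le_nn_integral) auto
    also have "\<dots> = (\<integral>\<^sup>+z. ennreal (pmf p u / 4) * ennreal (pmf p z) \<partial>count_space (-{u}))"
      by (intro nn_integral_cong) (auto simp: B2 ennreal_mult'[symmetric])
    also have "\<dots> = ennreal (pmf p u / 4) * emeasure (measure_pmf p) (-{u})"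
      by (simp add: nn_integral_cmult nn_integral_pmf)
    also have "\<dots> \<le> ennreal (pmf p u / 4)"
      using mult_left_mono[OF measure_pmf.emeasure_le_1] by (metis mult.right_neutral zero_le)
    \<comment> \<open>The probability \<open>pmf p u / 2\<close> is split into two quarters, so that
      one cancels against the correction term.\<close>
    finally have "ennreal (pmf p u / 4) + ennreal (pmf p u / 4) \<le> emeasure noise {x. marked p x = {u}} + ennreal (pmf p u / 4)"
      by (simp add: B1 add_left_mono flip: ennreal_plus)
    then show ?thesis by (simp add: ennreal_add_left_cancel_le add.commute)
  qed
  have "ennreal (1/4) = (\<integral>\<^sup>+u. ennreal (1/4) * ennreal (pmf p u) \<partial>count_space UNIV)"
    by (simp add: nn_integral_cmult nn_integral_pmf)
  also have "\<dots> \<le> (\<integral>\<^sup>+u. emeasure noise {x. marked p x = {u}} \<partial>count_space UNIV)"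
    using one by (intro nn_integral_mono) (simp add: ennreal_mult'[symmetric])
  also have "\<dots> = emeasure noise (\<Union>u\<in>UNIV. {x. marked p x = {u}})"
    by (rule emeasure_UN_countable[symmetric]) (auto simp: disjoint_family_on_def intro: sets_marked_eq)
  also have "(\<Union>u\<in>UNIV. {x. marked p x = {u}}) = {x. \<exists>u. marked p x = {u}}"
    by auto
  finally show ?thesis .
qed

section \<open>Repeated rounds and the first settled one\<close>

definition settled :: "'g pmf \<Rightarrow> ('g \<Rightarrow> real) \<Rightarrow> bool"
  where "settled p x \<longleftrightarrow> (\<exists>u. marked p x = {u})"

lemma sets_settled [measurable]:
  fixes p :: "'g::countable pmf"
  shows "{x. settled p x} \<in> sets noise"
proof -
  have "{x. settled p x} = (\<Union>u. {x. marked p x = {u}})"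
    by (auto simp: settled_def)
  then show ?thesis by (auto intro!: sets.countable_UN' sets_marked_eq)
qed

text \<open>The rounds are independent and each fails with probability at most 3/4. The bound is
  uniform in \<open>p\<close>, so one N serves all vertices, relations and stages.\<close>

lemma emeasure_never_settled:
  fixes p :: "'g::countable pmf"
  shows "emeasure noises {\<omega>. \<forall>i<N. \<not> settled p (\<omega> i)} \<le> ennreal ((3/4) ^ N)"
proof -
  interpret prob_space "noise :: ('g \<Rightarrow> real) measure" by (rule prob_space_noise)
  have [measurable]: "{x. \<not> settled p x} \<in> sets noise"
    using sets.compl_sets[OF sets_settled[of p]] by (simp add: Compl_eq_Diff_UNIV[symmetric] Collect_neg_eq)
  have "ennreal (1/4) \<le> emeasure noise {x. settled p x}"
    unfolding settled_def by (rule emeasure_marked_singleton)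
  then have "1/4 \<le> prob {x. settled p x}"
    by (simp add: emeasure_eq_measure)
  then have "prob {x. \<not> settled p x} \<le> 3/4"
    using prob_compl[OF sets_settled[of p]] by (simp add: Compl_eq_Diff_UNIV[symmetric] Collect_neg_eq)
  moreover have "emeasure noises {\<omega>. \<forall>i<N. \<not> settled p (\<omega> i)} = (\<Prod>i<N. emeasure noise {x. \<not> settled p x})"
    using emeasure_noises_box[of "{..<N}" "\<lambda>_. {x. \<not> settled p x}"] by (simp add: Ball_def)
  ultimately show ?thesis
    by (simp add: emeasure_eq_measure ennreal_power power_mono)
qed

lemma emeasure_noises_round:
  assumes [measurable]: "B \<in> sets noise"
  shows "emeasure noises {\<omega>. \<omega> i \<in> B} = emeasure noise B"
  using emeasure_noises_box[of "{i}" "\<lambda>_. B"] by simp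

text \<open>A union bound over rounds. It grows with N and would be void over all rounds, which is
  why comparisons stop at a finite horizon.\<close>

lemma emeasure_sometime_marked_neq:
  fixes p q :: "'g::countable pmf" and N :: nat
  shows "emeasure noises {\<omega>. \<exists>i<N. marked p (\<omega> i) \<noteq> marked q (\<omega> i)} \<le> ennreal (N * l1_dist p q)"
proof -
  define B where "B = {x. marked p x \<noteq> marked q x}"
  have [measurable]: "B \<in> sets noise"
    using sets.compl_sets[OF sets_marked_eq(2)[of p q]]
    by (simp add: B_def Compl_eq_Diff_UNIV[symmetric] Collect_neg_eq)
  have [measurable]: "{\<omega>. \<omega> i \<in> B} \<in> sets noises" for i
    using measurable_sets[OF measurable_noises_eval[of i] \<open>B \<in> sets noise\<close>] by (simp add: vimage_def)
  have "emeasure noises {\<omega>. \<exists>i<N. marked p (\<omega> i) \<noteq> marked q (\<omega> i)} = emeasure noises (\<Union>i<N. {\<omega>. \<omega> i \<in> B})"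
    by (rule arg_cong[of _ _ "emeasure noises"]) (auto simp: B_def)
  also have "\<dots> \<le> (\<Sum>i<N. emeasure noises {\<omega>. \<omega> i \<in> B})"
    by (rule emeasure_subadditive_finite) auto
  also have "\<dots> \<le> (\<Sum>i<N. ennreal (l1_dist p q))"
    using emeasure_marked_neq[of p q] by (intro sum_mono) (simp add: emeasure_noises_round B_def[symmetric])
  also have "\<dots> = ennreal (N * l1_dist p q)"
    by (simp add: ennreal_mult' ennreal_of_nat_eq_real_of_nat)
  finally show ?thesis .
qed

text \<open>The default 0 is taken when no round is settled, a null event by
  \<open>emeasure_never_settled\<close> as N grows.\<close>

definition select :: "'g::zero pmf \<Rightarrow> (nat \<Rightarrow> 'g \<Rightarrow> real) \<Rightarrow> 'g"
  where "select p \<omega> = (if \<exists>i. settled p (\<omega> i)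
    then the_elem (marked p (\<omega> (LEAST i. settled p (\<omega> i)))) else 0)"

text \<open>Removes \<open>LEAST\<close>: at most one round can be the first settled one. The first
  disjunct is a countable union of events about finitely many rounds, a form suited both to
  measurability and to comparing two selections.\<close>

lemma select_eq_iff:
  "select p \<omega> = u \<longleftrightarrow>
    (\<exists>i. (\<forall>j<i. \<not> settled p (\<omega> j)) \<and> marked p (\<omega> i) = {u}) \<or> ((\<forall>i. \<not> settled p (\<omega> i)) \<and> u = 0)"
proof (cases "\<exists>i. settled p (\<omega> i)")
  case True
  define k where "k = (LEAST i. settled p (\<omega> i))"
  have k: "settled p (\<omega> k)" "\<And>j. j < k \<Longrightarrow> \<not> settled p (\<omega> j)"
    using True unfolding k_def by (auto intro: LeastI dest: not_less_Least)
  then obtain z where z: "marked p (\<omega> k) = {z}" by (auto simp: settled_def)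
  have "i = k" if "\<forall>j<i. \<not> settled p (\<omega> j)" "marked p (\<omega> i) = {u}" for i
    using that k by (metis linorder_neqE_nat settled_def)
  moreover have "select p \<omega> = z"
    using True z by (simp add: select_def k_def)
  ultimately show ?thesis
    using True z k by auto
qed (auto simp: select_def settled_def)

section \<open>Equivariance of selections and centres\<close>

lemma marked_translate:
  fixes p :: "'g::group_add pmf"
  shows "marked (translate_pmf g p) x = (+) g ` marked p (\<lambda>u. x (g + u))"
proof (intro set_eqI iffI)
  fix u assume "u \<in> marked (translate_pmf g p) x"
  then have "- g + u \<in> marked p (\<lambda>u. x (g + u))"
    by (simp add: marked_def pmf_translate_pmf add.assoc[symmetric])
  then show "u \<in> (+) g ` marked p (\<lambda>u. x (g + u))"
    by (rule rev_image_eqI) (simp add: add.assoc[symmetric])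
qed (auto simp: marked_def pmf_translate_pmf add.assoc[symmetric])

lemma settled_translate:
  fixes p :: "'g::group_add pmf"
  shows "settled (translate_pmf g p) x \<longleftrightarrow> settled p (\<lambda>u. x (g + u))"
proof -
  have "(\<exists>u. (+) g ` A = {u}) \<longleftrightarrow> (\<exists>u. A = {u})" for A :: "'g set"
  proof
    assume "\<exists>u. (+) g ` A = {u}"
    then obtain u where u: "(+) g ` A = {u}" ..
    have "(+) (- g) ` (+) g ` A = A"
      by (simp add: image_image add.assoc[symmetric])
    then show "\<exists>u. A = {u}" unfolding u by auto
  qed auto
  then show ?thesis by (simp add: settled_def marked_translate)
qed

text \<open>The assumption excludes the default, for which the left side would be 0 and the right
  side \<open>g\<close>.\<close>

lemma select_translate:
  fixes p :: "'g::group_add pmf"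
  assumes "\<exists>i. settled (translate_pmf g p) (\<omega> i)"
  shows "select (translate_pmf g p) \<omega> = g + select p (\<lambda>i u. \<omega> i (g + u))"
proof -
  obtain i where i: "\<forall>j<i. \<not> settled p (\<lambda>u. \<omega> j (g + u))"
    "marked p (\<lambda>u. \<omega> i (g + u)) = {select p (\<lambda>i u. \<omega> i (g + u))}"
    using assms select_eq_iff[of p "\<lambda>i u. \<omega> i (g + u)" "select p (\<lambda>i u. \<omega> i (g + u))"]
    by (auto simp: settled_translate)
  show ?thesis
    unfolding select_eq_iff by (rule disjI1, rule exI[of _ i]) (simp add: i settled_translate marked_translate)
qed

text \<open>Reading the noise relative to \<open>v\<close> keeps \<open>centre\<close> equivariant also when no round is settled
  and \<open>select\<close> takes its default value.\<close>

definition centre :: "(('g \<times> 'g \<Rightarrow> bool) \<Rightarrow> 'g pmf) \<Rightarrow> ('g \<times> 'g \<Rightarrow> bool) \<Rightarrow> (nat \<Rightarrow> 'g \<Rightarrow> real) \<Rightarrow> 'g::group_add \<Rightarrow> 'g"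
  where "centre \<mu> r \<omega> v = v + select (\<mu> (shift_rel (- v) r)) (\<lambda>i u. \<omega> i (v + u))"

text \<open>Here \<open>p v r\<close> is the measure carried by v. If some round before N is settled
  for v and the first N markings agree, then both vertices read the same singleton in the same
  round.\<close>

lemma centre_neqD:
  fixes \<mu> :: "('g::group_add \<times> 'g \<Rightarrow> bool) \<Rightarrow> 'g pmf"
  defines "p v r \<equiv> translate_pmf v (\<mu> (shift_rel (- v) r))"
  assumes "centre \<mu> r \<omega> v \<noteq> centre \<mu> r \<omega> w"
  shows "(\<forall>i<N. \<not> settled (p v r) (\<omega> i)) \<or> (\<exists>i<N. marked (p v r) (\<omega> i) \<noteq> marked (p w r) (\<omega> i))"
proof (rule ccontr)
  assume "\<not> ?thesis"
  then obtain k where k: "k < N" "settled (p v r) (\<omega> k)"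
    and eq: "\<And>i. i < N \<Longrightarrow> marked (p v r) (\<omega> i) = marked (p w r) (\<omega> i)"
    by auto
  have settled_eq: "settled (p v r) (\<omega> i) \<longleftrightarrow> settled (p w r) (\<omega> i)" if "i < N" for i
    using eq[OF that] by (simp add: settled_def)
  \<comment> \<open>Both vertices have a settled round, so the relative reading of the noise can be
    undone: each centre is a selection from the translated measure by the common noise
    \<open>\<omega>\<close>.\<close>
  have "centre \<mu> r \<omega> v = select (p v r) \<omega>" "centre \<mu> r \<omega> w = select (p w r) \<omega>"
    using k settled_eq unfolding p_def centre_def by (metis select_translate)+
  moreover obtain i where i: "\<forall>j<i. \<not> settled (p v r) (\<omega> j)" "marked (p v r) (\<omega> i) = {select (p v r) \<omega>}"
    using k select_eq_iff[of "p v r" \<omega> "select (p v r) \<omega>"] by auto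
  \<comment> \<open>The first settled round comes no later than the settled round k, which is below
    N.\<close>
  moreover have "i < N"
    using i k by (meson not_less order_trans le_less_trans linorder_neqE_nat less_trans)
  ultimately have "select (p w r) \<omega> = select (p v r) \<omega>"
    unfolding select_eq_iff using eq settled_eq by (intro disjI1 exI[of _ i]) auto
  with assms(2) show False
    using \<open>centre \<mu> r \<omega> v = _\<close> \<open>centre \<mu> r \<omega> w = _\<close> by simp
qed

lemma centre_equivariant:
  "centre \<mu> (shift_rel g r) (\<lambda>i u. \<omega> i (- g + u)) (g + v) = g + centre \<mu> r \<omega> v"
proof -
  have "- (g + v) + g = - v"
    by (simp add: minus_add add.assoc diff_conv_add_uminus del: add_uminus_conv_diff)
  then show ?thesis
    by (simp add: centre_def shift_shift_rel add.assoc[symmetric])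
qed

text \<open>Left translation by \<open>w\<close> is an l1-isometry and carries the right side to the
  left. The right side is the quantity in the definition of amenability, for the relation
  \<open>shift_rel (- v) r\<close> and the group element \<open>- v + w\<close>.\<close>

lemma l1_dist_centre:
  "l1_dist (translate_pmf v (\<mu> (shift_rel (- v) r))) (translate_pmf w (\<mu> (shift_rel (- w) r)))
    = l1_dist (translate_pmf (- (- v + w)) (\<mu> (shift_rel (- v) r))) (\<mu> (shift_rel (- (- v + w)) (shift_rel (- v) r)))"
proof -
  have a: "- (- v + w) = - w + v" "- w + v + - v = - w"
    by (simp_all add: minus_add add.assoc diff_conv_add_uminus del: add_uminus_conv_diff)
  show ?thesis
    unfolding shift_shift_rel a
    by (subst l1_dist_translate[of w, symmetric]) (simp add: translate_translate_pmf add.assoc[symmetric])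
qed

section \<open>Measurability of selections\<close>

lemma measurable_marked_eq:
  fixes p :: "'a \<Rightarrow> 'g::countable pmf"
  assumes [measurable]: "p \<in> measurable M Prob_borel" "x \<in> measurable M noise"
  shows "Measurable.pred M (\<lambda>a. marked (p a) (x a) = S)"
  unfolding marked_def set_eq_iff by measurable

lemma measurable_select:
  fixes p :: "'a \<Rightarrow> 'g::{countable,zero} pmf"
  assumes [measurable]: "p \<in> measurable M Prob_borel" "x \<in> measurable M noises"
  shows "(\<lambda>a. select (p a) (x a)) \<in> measurable M (count_space UNIV)"
proof -
  have [measurable]: "Measurable.pred M (\<lambda>a. marked (p a) (x a i) = S)" for i S
    by (rule measurable_marked_eq) measurable
  have "{a \<in> space M. select (p a) (x a) = u} \<in> sets M" for u
    unfolding select_eq_iff settled_def by measurable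
  then show ?thesis
    unfolding measurable_count_space_eq2_countable by (auto simp: vimage_def Int_def conj_commute)
qed

section \<open>Translation invariance of the noise\<close>

lemma measurable_PiM_map:
  assumes [measurable]: "t \<in> measurable M M"
  shows "(\<lambda>\<omega> i. t (\<omega> i)) \<in> measurable (PiM UNIV (\<lambda>_::'i. M)) (PiM UNIV (\<lambda>_. M))"
  using measurable_restrict[of UNIV "\<lambda>i \<omega>. t (\<omega> i)" "PiM UNIV (\<lambda>_::'i. M)" "\<lambda>_. M"]
    measurable_compose[OF measurable_component_singleton[where M = "\<lambda>_. M"] assms]
  by (simp add: restrict_def)

text \<open>The preimage of a finite box under the coordinatewise map is a box whose sides are
  preimages under \<open>t\<close>, and finite boxes determine the product measure. It passes from
  invariance of one round to invariance of all rounds.\<close>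

lemma distr_PiM_map:
  assumes t: "t \<in> measurable M M" "distr M M t = M" and "prob_space M"
  shows "distr (PiM UNIV (\<lambda>_::'i. M)) (PiM UNIV (\<lambda>_. M)) (\<lambda>\<omega> i. t (\<omega> i)) = PiM UNIV (\<lambda>_. M)"
    (is "distr ?P ?P ?t = ?P")
proof (rule measure_eqI_PiM_infinite[symmetric, OF refl])
  interpret prob_space ?P using assms by (intro prob_space_PiM)
  show "finite_measure ?P" by unfold_locales
  note t[measurable] measurable_PiM_map[OF t(1), measurable]
  fix A and J :: "'i set" assume J: "finite J" "J \<subseteq> UNIV" and A: "\<And>i. i \<in> J \<Longrightarrow> A i \<in> sets M"
  have pre: "emeasure M (A i) = emeasure M (t -` A i \<inter> space M)" if "i \<in> J" for i
    using emeasure_distr[OF t(1) A[OF that]] t(2) by simp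
  have "emeasure ?P (prod_emb UNIV (\<lambda>_. M) J (Pi\<^sub>E J A)) = (\<Prod>i\<in>J. emeasure M (A i))"
    using J A assms(3) by (simp add: emeasure_PiM_emb)
  also have "\<dots> = (\<Prod>i\<in>J. emeasure M (t -` A i \<inter> space M))"
    by (intro prod.cong pre) auto
  also have "\<dots> = emeasure ?P (prod_emb UNIV (\<lambda>_. M) J (\<Pi>\<^sub>E i\<in>J. t -` A i \<inter> space M))"
    using J A assms(3) by (simp add: emeasure_PiM_emb measurable_sets[OF t(1)])
  also have "prod_emb UNIV (\<lambda>_. M) J (\<Pi>\<^sub>E i\<in>J. t -` A i \<inter> space M) =
      ?t -` prod_emb UNIV (\<lambda>_. M) J (Pi\<^sub>E J A) \<inter> space ?P"
    using measurable_space[OF t(1)] by (auto simp: prod_emb_def space_PiM PiE_iff)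
  also have "emeasure ?P \<dots> = emeasure (distr ?P ?P ?t) (prod_emb UNIV (\<lambda>_. M) J (Pi\<^sub>E J A))"
    using J A by (intro emeasure_distr[symmetric] sets_PiM_I) auto
  finally show "emeasure ?P (prod_emb UNIV (\<lambda>_. M) J (Pi\<^sub>E J A)) =
      emeasure (distr ?P ?P ?t) (prod_emb UNIV (\<lambda>_. M) J (Pi\<^sub>E J A))" .
qed simp

definition translate_noise :: "'g::group_add \<Rightarrow> (nat \<Rightarrow> 'g \<Rightarrow> real) \<Rightarrow> nat \<Rightarrow> 'g \<Rightarrow> real"
  where "translate_noise g \<omega> = (\<lambda>i u. \<omega> i (- g + u))"

lemma measurable_translate_noise1: "(\<lambda>x u. x (- g + u)) \<in> measurable noise noise"
proof -
  have "(\<lambda>x. x (- g + u)) \<in> measurable noise (uniform_measure lborel {0..1::real})" for u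
    unfolding noise_def by measurable
  then have "(\<lambda>x. \<lambda>u\<in>UNIV. x (- g + u)) \<in> measurable noise noise"
    unfolding noise_def by (intro measurable_restrict)
  then show ?thesis by (simp add: restrict_def)
qed

lemma measurable_translate_noise [measurable]: "translate_noise g \<in> measurable noises noises"
  using measurable_PiM_map[OF measurable_translate_noise1[of g]]
  by (simp add: noises_def translate_noise_def[abs_def])

lemma distr_translate_noise: "distr noises noises (translate_noise g) = noises"
proof -
  \<comment> \<open>Within a round the coordinates are i.i.d., so permuting them by a left
    translation preserves the law.\<close>
  have "distr noise noise (\<lambda>x u. x (- g + u)) = noise"
    using distr_PiM_reindex[of UNIV "\<lambda>_. uniform_measure lborel {0..1::real}" "(+) (- g)" UNIV]
    by (simp add: noise_def prob_space_uniform restrict_def)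
  then show ?thesis
    using distr_PiM_map[OF measurable_translate_noise1 _ prob_space_noise, of g]
    by (simp add: noises_def translate_noise_def[abs_def])
qed

section \<open>Clustering a random equivalence relation\<close>

definition cluster :: "(('g \<times> 'g \<Rightarrow> bool) \<Rightarrow> 'g pmf) \<Rightarrow> ('g \<times> 'g \<Rightarrow> bool) \<Rightarrow> (nat \<Rightarrow> 'g \<Rightarrow> real) \<Rightarrow> 'g::group_add \<times> 'g \<Rightarrow> bool"
  where "cluster \<mu> r \<omega> = (\<lambda>(v, w). r (v, w) \<and> centre \<mu> r \<omega> v = centre \<mu> r \<omega> w)"

lemma cluster_equiv_rels:
  assumes "r \<in> equiv_rels"
  shows "cluster \<mu> r \<omega> \<in> equiv_rels"
  unfolding equiv_rels_iff cluster_def case_prod_conv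
proof (intro conjI allI impI)
  show "r (x, x)" for x
    using assms unfolding equiv_rels_iff by (elim conjE) (rule spec)
  show "r (y, x)" if "r (x, y) \<and> centre \<mu> r \<omega> x = centre \<mu> r \<omega> y" for x y
    using assms conjunct1[OF that] unfolding equiv_rels_iff by metis
  show "r (x, z)" if "r (x, y) \<and> centre \<mu> r \<omega> x = centre \<mu> r \<omega> y"
    "r (y, z) \<and> centre \<mu> r \<omega> y = centre \<mu> r \<omega> z" for x y z
    using assms conjunct1[OF that(1)] conjunct1[OF that(2)] unfolding equiv_rels_iff by metis
qed simp_all

lemma centre_translate:
  "centre \<mu> (shift_rel g r) (translate_noise g \<omega>) v = g + centre \<mu> r \<omega> (- g + v)"
  using centre_equivariant[of \<mu> g r \<omega> "- g + v"] by (simp add: translate_noise_def add.assoc[symmetric])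

lemma cluster_equivariant:
  "cluster \<mu> (shift_rel g r) (translate_noise g \<omega>) = shift_rel g (cluster \<mu> r \<omega>)"
  unfolding cluster_def centre_translate by (simp add: shift_rel_def)

text \<open>One stage of the approximating sequence. Invariance and finiteness are established stage
  by stage; amenability enters in the passage to the limit.\<close>

locale random_clustering =
  fixes \<rho> :: "('g::{group_add,countable} \<times> 'g \<Rightarrow> bool) measure"
    and \<mu> :: "('g \<times> 'g \<Rightarrow> bool) \<Rightarrow> 'g pmf"
  assumes IRE: "IRE \<rho>" and measurable_\<mu>[measurable]: "\<mu> \<in> measurable Rel_borel Prob_borel"
begin

lemma sets_\<rho> [measurable_cong, simp]: "sets \<rho> = sets Rel_borel"
  using IRE by (simp add: IRE_def)

lemma space_\<rho> [simp]: "space \<rho> = equiv_rels"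
  using sets_eq_imp_space_eq[OF sets_\<rho>] by (simp add: space_Rel_borel)

lemma distr_shift_\<rho>: "distr \<rho> \<rho> (shift_rel g) = \<rho>"
  using IRE by (simp add: IRE_def)

sublocale rho: prob_space \<rho>
  using IRE by (simp add: IRE_def)

sublocale noises: prob_space "noises :: (nat \<Rightarrow> 'g \<Rightarrow> real) measure"
  by (rule prob_space_noises)

sublocale pair_prob_space \<rho> "noises :: (nat \<Rightarrow> 'g \<Rightarrow> real) measure" ..

text \<open>The relation and the noise are independent. On this space \<open>\<rho>\<close> is the
  law of the relation and \<open>clustered\<close> the law of its clustering, so their integrals can
  be compared pointwise.\<close>

definition coupling :: "(('g \<times> 'g \<Rightarrow> bool) \<times> (nat \<Rightarrow> 'g \<Rightarrow> real)) measure"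
  where "coupling = \<rho> \<Otimes>\<^sub>M noises"

lemma sets_coupling [measurable_cong]: "sets coupling = sets (Rel_borel \<Otimes>\<^sub>M noises)"
  unfolding coupling_def by (intro sets_pair_measure_cong) simp_all

lemma space_coupling: "space coupling = equiv_rels \<times> UNIV"
  by (simp add: coupling_def space_pair_measure)

sublocale coupling: prob_space coupling
  unfolding coupling_def by unfold_locales

lemma measurable_centre [measurable]:
  "(\<lambda>x. centre \<mu> (fst x) (snd x) v) \<in> measurable coupling (count_space UNIV)"
proof -
  \<comment> \<open>Reading the noise relative to v is translating it by \<open>- v\<close>.\<close>
  have "(\<lambda>x. translate_noise (- v) (snd x)) \<in> measurable coupling noises"
    by measurable
  then have [measurable]: "(\<lambda>x i u. snd x i (v + u)) \<in> measurable coupling noises"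
    by (simp add: translate_noise_def)
  have [measurable]: "(\<lambda>x. select (\<mu> (shift_rel (- v) (fst x))) (\<lambda>i u. snd x i (v + u))) \<in> measurable coupling (count_space UNIV)"
    by (rule measurable_select) measurable
  show ?thesis
    unfolding centre_def by measurable
qed

lemma measurable_cluster [measurable]:
  "(\<lambda>x. cluster \<mu> (fst x) (snd x)) \<in> measurable coupling Rel_borel"
proof (rule measurable_into_Rel_borel)
  fix p :: "'g \<times> 'g"
  obtain v w where p: "p = (v, w)" by force
  have "Measurable.pred coupling (\<lambda>x. fst x (v, w))"
    by (rule measurable_compose[OF _ measurable_Rel_borel_eval]) measurable
  \<comment> \<open>Equality of centres is written with a witness u, hence as a countable union of
    measurable events.\<close>
  moreover have "Measurable.pred coupling (\<lambda>x. \<exists>u. centre \<mu> (fst x) (snd x) v = u \<and> centre \<mu> (fst x) (snd x) w = u)"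
    by measurable
  ultimately show "Measurable.pred coupling (\<lambda>x. cluster \<mu> (fst x) (snd x) p)"
    by (simp add: cluster_def p eq_commute)
qed (auto simp: space_coupling cluster_equiv_rels)

definition translate :: "'g \<Rightarrow> ('g \<times> 'g \<Rightarrow> bool) \<times> (nat \<Rightarrow> 'g \<Rightarrow> real) \<Rightarrow> ('g \<times> 'g \<Rightarrow> bool) \<times> (nat \<Rightarrow> 'g \<Rightarrow> real)"
  where "translate g = (\<lambda>(r, \<omega>). (shift_rel g r, translate_noise g \<omega>))"

lemma measurable_translate [measurable]: "translate g \<in> measurable coupling coupling"
  unfolding translate_def by measurable

lemma distr_translate: "distr coupling coupling (translate g) = coupling"
proof -
  have "distr \<rho> \<rho> (shift_rel g) \<Otimes>\<^sub>M distr noises noises (translate_noise g) =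
      distr (\<rho> \<Otimes>\<^sub>M noises) (\<rho> \<Otimes>\<^sub>M noises) (\<lambda>(r, \<omega>). (shift_rel g r, translate_noise g \<omega>))"
  proof (rule pair_measure_distr)
    show "shift_rel g \<in> measurable \<rho> \<rho>" by measurable
    show "sigma_finite_measure (distr noises noises (translate_noise g :: _ \<Rightarrow> _ \<Rightarrow> 'g \<Rightarrow> real))"
      unfolding distr_translate_noise by unfold_locales
  qed measurable
  then show ?thesis
    by (simp add: distr_shift_\<rho> distr_translate_noise coupling_def translate_def)
qed

definition clustered :: "('g \<times> 'g \<Rightarrow> bool) measure"
  where "clustered = distr coupling Rel_borel (\<lambda>x. cluster \<mu> (fst x) (snd x))"

text \<open>An equivariant image of an invariant measure is invariant:
  \<open>cluster_equivariant\<close> turns the shift of the image into a simultaneous translation of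
  relation and noise, which \<open>distr_translate\<close> absorbs.\<close>

lemma IRE_clustered: "IRE clustered"
  unfolding IRE_def
proof (intro conjI allI)
  show "prob_space clustered"
    unfolding clustered_def by (rule coupling.prob_space_distr) measurable
  show sets: "sets clustered = sets Rel_borel"
    by (simp add: clustered_def)
  fix g
  have "distr clustered clustered (shift_rel g) = distr clustered Rel_borel (shift_rel g)"
    by (rule distr_cong) (simp_all add: sets)
  also have "\<dots> = distr coupling Rel_borel (\<lambda>x. shift_rel g (cluster \<mu> (fst x) (snd x)))"
    unfolding clustered_def by (subst distr_distr) (simp_all add: o_def)
  also have "\<dots> = distr coupling Rel_borel ((\<lambda>x. cluster \<mu> (fst x) (snd x)) \<circ> translate g)"
    by (rule distr_cong) (auto simp: translate_def cluster_equivariant)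
  also have "\<dots> = distr (distr coupling coupling (translate g)) Rel_borel (\<lambda>x. cluster \<mu> (fst x) (snd x))"
    by (rule distr_distr[symmetric]) measurable
  also have "\<dots> = clustered"
    by (simp add: distr_translate clustered_def)
  finally show "distr clustered clustered (shift_rel g) = clustered" .
qed

text \<open>The map \<open>translate (- v)\<close> preserves \<open>coupling\<close>, moves v to 0
  and moves a centre u to \<open>- v + u\<close>.\<close>

lemma emeasure_centre_eq:
  "emeasure coupling {x \<in> space coupling. centre \<mu> (fst x) (snd x) v = u} =
   emeasure coupling {x \<in> space coupling. centre \<mu> (fst x) (snd x) 0 = - v + u}"
proof -
  let ?A = "{x \<in> space coupling. centre \<mu> (fst x) (snd x) 0 = - v + u}"
  have "emeasure coupling ?A = emeasure (distr coupling coupling (translate (- v))) ?A"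
    by (simp only: distr_translate)
  also have "\<dots> = emeasure coupling (translate (- v) -` ?A \<inter> space coupling)"
    by (rule emeasure_distr) measurable
  also have "translate (- v) -` ?A \<inter> space coupling = {x \<in> space coupling. centre \<mu> (fst x) (snd x) v = u}"
    by (auto simp: translate_def centre_translate space_coupling shift_rel_equiv_rels)
  finally show ?thesis ..
qed

text \<open>Mass transport: by invariance the expected number of \<open>v\<close> with centre \<open>u\<close> equals the expected
  number of \<open>k\<close> with \<open>centre 0 = k\<close>, which is 1.\<close>

lemma AE_finite_fibre: "AE x in coupling. finite {v. centre \<mu> (fst x) (snd x) v = u}"
proof -
  let ?c = "\<lambda>x. centre \<mu> (fst x) (snd x)"
  \<comment> \<open>This bijection turns the sum over the vertices v sending mass to u into a sum
    over the possible centres of 0.\<close>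
  have bij: "bij (\<lambda>v. - v + u)"
    by (rule bij_betw_byWitness[of _ "\<lambda>k. u - k"]) (auto simp: minus_add diff_conv_add_uminus add.assoc simp del: add_uminus_conv_diff)
  have "(\<integral>\<^sup>+x. (\<integral>\<^sup>+v. indicator {x \<in> space coupling. ?c x v = u} x \<partial>count_space UNIV) \<partial>coupling) =
      (\<integral>\<^sup>+v. emeasure coupling {x \<in> space coupling. ?c x v = u} \<partial>count_space UNIV)"
    by (subst nn_integral_count_space_nn_integral) simp_all
  also have "\<dots> = (\<integral>\<^sup>+v. emeasure coupling {x \<in> space coupling. ?c x 0 = - v + u} \<partial>count_space UNIV)"
    by (intro nn_integral_cong emeasure_centre_eq)
  also have "\<dots> = (\<integral>\<^sup>+k. emeasure coupling {x \<in> space coupling. ?c x 0 = k} \<partial>count_space UNIV)"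
    using nn_integral_bij_count_space[OF bij] .
  also have "\<dots> = emeasure coupling (\<Union>k. {x \<in> space coupling. ?c x 0 = k})"
    by (rule emeasure_UN_countable[symmetric]) (auto simp: disjoint_family_on_def)
  also have "\<dots> \<noteq> \<infinity>" by simp
  finally have fin: "(\<integral>\<^sup>+x. (\<integral>\<^sup>+v. indicator {x \<in> space coupling. ?c x v = u} x \<partial>count_space UNIV) \<partial>coupling) \<noteq> \<infinity>" .
  \<comment> \<open>Joint measurability makes the size of the fibre, an inner integral against
    counting measure, a measurable function.\<close>
  have "(\<lambda>(x, v). indicator {x \<in> space coupling. ?c x v = u} x :: ennreal) \<in> borel_measurable (coupling \<Otimes>\<^sub>M count_space UNIV)"
    using measurable_compose_countable[of "\<lambda>v x. indicator {y \<in> space coupling. ?c y v = u} (fst x)"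
        "coupling \<Otimes>\<^sub>M count_space UNIV" "borel :: ennreal measure" snd]
    by (simp add: case_prod_unfold)
  then have "(\<lambda>x. \<integral>\<^sup>+v. indicator {x \<in> space coupling. ?c x v = u} x \<partial>count_space UNIV) \<in> borel_measurable coupling"
    using sigma_finite_measure.borel_measurable_nn_integral[OF sigma_finite_measure_count_space] by fastforce
  then have "AE x in coupling. (\<integral>\<^sup>+v. indicator {x \<in> space coupling. ?c x v = u} x \<partial>count_space UNIV) \<noteq> \<infinity>"
    using fin by (rule nn_integral_PInf_AE)
  then show ?thesis
  proof (rule AE_mp, intro AE_I2 impI)
    fix x assume x: "x \<in> space coupling" and fin: "(\<integral>\<^sup>+v. indicator {x \<in> space coupling. ?c x v = u} x \<partial>count_space UNIV) \<noteq> \<infinity>"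
    have "(\<integral>\<^sup>+v. indicator {x \<in> space coupling. ?c x v = u} x \<partial>count_space UNIV) =
        (\<integral>\<^sup>+v. indicator {v. ?c x v = u} v \<partial>count_space UNIV)"
      using x by (intro nn_integral_cong) (auto split: split_indicator)
    also have "\<dots> = emeasure (count_space UNIV) {v. ?c x v = u}"
      by simp
    finally show "finite {v. ?c x v = u}"
      using fin by (auto simp: emeasure_count_space split: if_splits)
  qed
qed

lemma finite_IRE_clustered: "finite_IRE clustered"
  unfolding finite_IRE_def
proof (intro conjI IRE_clustered)
  \<comment> \<open>Finite sets are replaced by lists because the lists over a countable group form
    a countable type; the event is then a countable combination of coordinate events.\<close>
  have fin: "finite (rel_class r g) \<longleftrightarrow> (\<exists>xs. \<forall>v. r (g, v) \<longrightarrow> v \<in> set xs)" for r and g :: 'g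
  proof -
    have "finite (rel_class r g) \<longleftrightarrow> (\<exists>xs. rel_class r g \<subseteq> set xs)"
      by (metis List.finite_set finite_list finite_subset order_refl)
    then show ?thesis by (auto simp: rel_class_def subset_iff)
  qed
  have S: "{r \<in> space Rel_borel. \<forall>g. finite (rel_class r g)} \<in> sets (Rel_borel :: ('g \<times> 'g \<Rightarrow> bool) measure)"
    unfolding fin by measurable
  show "AE r in clustered. \<forall>g. finite (rel_class r g)"
    unfolding clustered_def AE_distr_iff[OF measurable_cluster S]
  proof -
    have "AE x in coupling. \<forall>u. finite {v. centre \<mu> (fst x) (snd x) v = u}"
      by (simp add: AE_all_countable AE_finite_fibre)
    then show "AE x in coupling. \<forall>g. finite (rel_class (cluster \<mu> (fst x) (snd x)) g)"
    proof (rule AE_mp, intro AE_I2 impI allI)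
      fix x g assume "\<forall>u. finite {v. centre \<mu> (fst x) (snd x) v = u}"
      \<comment> \<open>The class of g is contained in the fibre over the centre of g.\<close>
      then show "finite (rel_class (cluster \<mu> (fst x) (snd x)) g)"
        by (rule finite_subset[rotated, OF spec[of _ "centre \<mu> (fst x) (snd x) g"]])
          (auto simp: rel_class_def cluster_def)
    qed
  qed
qed

section \<open>The probability that a pair is separated, and its effect on integrals\<close>

definition cut :: "'g \<times> 'g \<Rightarrow> (('g \<times> 'g \<Rightarrow> bool) \<times> (nat \<Rightarrow> 'g \<Rightarrow> real)) set"
  where "cut p = {x \<in> space coupling. cluster \<mu> (fst x) (snd x) p \<noteq> fst x p}"

lemma sets_cut [measurable]: "cut p \<in> sets coupling"
proof -
  have [measurable]: "Measurable.pred coupling (\<lambda>x. fst x p)"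
    by (rule measurable_compose[OF _ measurable_Rel_borel_eval]) measurable
  have [measurable]: "Measurable.pred coupling (\<lambda>x. cluster \<mu> (fst x) (snd x) p)"
    by (rule measurable_compose[OF _ measurable_Rel_borel_eval]) measurable
  show ?thesis unfolding cut_def by measurable
qed

lemma emeasure_cut: "emeasure coupling (cut p) = (\<integral>\<^sup>+r. emeasure noises (Pair r -` cut p) \<partial>\<rho>)"
  using sets_cut unfolding coupling_def by (rule noises.emeasure_pair_measure_alt)

lemma measurable_cut_section [measurable]: "(\<lambda>r. emeasure noises (Pair r -` cut p)) \<in> borel_measurable \<rho>"
  using sets_cut unfolding coupling_def by (rule noises.measurable_emeasure_Pair)

text \<open>\<open>cluster\<close> only removes pairs, so an unrelated pair is never cut. For a
  related pair the two terms bound the two alternatives of \<open>centre_neqD\<close>. Everything is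
  expressed through \<open>s\<close> and \<open>- v + w\<close>, with v moved to the identity, to
  match the definition of amenability.\<close>

lemma emeasure_cut_section_le:
  fixes v w :: 'g
  assumes r: "r \<in> equiv_rels"
  defines "s \<equiv> shift_rel (- v) r"
  shows "emeasure noises (Pair r -` cut (v, w)) \<le>
    (if s (0, - v + w) then ennreal ((3/4) ^ N + N * l1_dist (translate_pmf (- (- v + w)) (\<mu> s)) (\<mu> (shift_rel (- (- v + w)) s))) else 0)"
proof (cases "r (v, w)")
  case True
  have "s (0, - v + w)"
    using True by (simp add: s_def shift_rel_def add.assoc[symmetric])
  define p where "p v = translate_pmf v (\<mu> (shift_rel (- v) r))" for v
  have [measurable]: "{\<omega>. \<forall>i<N. \<not> settled (p v) (\<omega> i)} \<in> sets noises"
    "{\<omega>. \<exists>i<N. marked (p v) (\<omega> i) \<noteq> marked (p w) (\<omega> i)} \<in> sets noises"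
  proof -
    have [measurable]: "Measurable.pred noises (\<lambda>\<omega>. settled (p v) (\<omega> i))" for i
      by (rule measurable_compose[OF measurable_noises_eval, of "\<lambda>x. settled (p v) x"])
        (use sets_settled[of "p v"] in \<open>simp add: pred_def\<close>)
    have [measurable]: "Measurable.pred noises (\<lambda>\<omega>. marked (p v) (\<omega> i) = marked (p w) (\<omega> i))" for i
      by (rule measurable_compose[OF measurable_noises_eval, of "\<lambda>x. marked (p v) x = marked (p w) x"])
        (use sets_marked_eq(2)[of "p v" "p w"] in \<open>simp add: pred_def\<close>)
    have "{\<omega> \<in> space noises. \<forall>i<N. \<not> settled (p v) (\<omega> i)} \<in> sets noises"
      "{\<omega> \<in> space noises. \<exists>i<N. marked (p v) (\<omega> i) \<noteq> marked (p w) (\<omega> i)} \<in> sets noises"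
      by measurable
    then show "{\<omega>. \<forall>i<N. \<not> settled (p v) (\<omega> i)} \<in> sets noises"
      "{\<omega>. \<exists>i<N. marked (p v) (\<omega> i) \<noteq> marked (p w) (\<omega> i)} \<in> sets noises"
      by simp_all
  qed
  have "Pair r -` cut (v, w) \<subseteq> {\<omega>. \<forall>i<N. \<not> settled (p v) (\<omega> i)} \<union> {\<omega>. \<exists>i<N. marked (p v) (\<omega> i) \<noteq> marked (p w) (\<omega> i)}"
    using centre_neqD[of \<mu> r _ v w N] by (auto simp: cut_def cluster_def p_def)
  then have "emeasure noises (Pair r -` cut (v, w)) \<le>
      emeasure noises ({\<omega>. \<forall>i<N. \<not> settled (p v) (\<omega> i)} \<union> {\<omega>. \<exists>i<N. marked (p v) (\<omega> i) \<noteq> marked (p w) (\<omega> i)})"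
    by (rule emeasure_mono) measurable
  also have "\<dots> \<le> emeasure noises {\<omega>. \<forall>i<N. \<not> settled (p v) (\<omega> i)} +
      emeasure noises {\<omega>. \<exists>i<N. marked (p v) (\<omega> i) \<noteq> marked (p w) (\<omega> i)}"
    by (rule emeasure_subadditive) measurable
  also have "\<dots> \<le> ennreal ((3/4) ^ N) + ennreal (N * l1_dist (p v) (p w))"
    by (intro add_mono emeasure_never_settled emeasure_sometime_marked_neq)
  also have "\<dots> = ennreal ((3/4) ^ N + N * l1_dist (p v) (p w))"
    by (intro ennreal_plus[symmetric]) (auto simp: Metric_space.nonneg[OF Metric_space_l1_dist])
  finally show ?thesis
    using \<open>s (0, - v + w)\<close> unfolding p_def l1_dist_centre[of v \<mu> r w] s_def by simp
next
  case False
  then have "Pair r -` cut (v, w) = {}" by (auto simp: cut_def cluster_def)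
  then show ?thesis by simp
qed

text \<open>Both integrals are taken over \<open>coupling\<close>. If no pair of F is cut, the two
  values of f differ by less than e; otherwise they differ by at most \<open>2 * B\<close>, and the
  sum of the indicators is at least 1.\<close>

lemma integral_clustered:
  fixes f :: "('g \<times> 'g \<Rightarrow> bool) \<Rightarrow> real"
  assumes f: "continuous_on equiv_rels f"
    and F: "finite F" "\<And>r s. r \<in> equiv_rels \<Longrightarrow> s \<in> equiv_rels \<Longrightarrow> (\<forall>p\<in>F. s p = r p) \<Longrightarrow> \<bar>f s - f r\<bar> < e"
    and B: "\<And>r. r \<in> equiv_rels \<Longrightarrow> \<bar>f r\<bar> \<le> B" and "0 < e"
  shows "\<bar>(\<integral>r. f r \<partial>clustered) - (\<integral>r. f r \<partial>\<rho>)\<bar> \<le> e + 2 * B * (\<Sum>p\<in>F. measure coupling (cut p))"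
proof -
  let ?cl = "\<lambda>x. cluster \<mu> (fst x) (snd x)"
  have fm[measurable]: "f \<in> borel_measurable Rel_borel"
    unfolding Rel_borel_def using f by (rule borel_measurable_continuous_on_restrict)
  \<comment> \<open>The full relation belongs to \<open>equiv_rels\<close>, so B bounds at least one
    absolute value.\<close>
  have B0: "0 \<le> B"
    using B[of "\<lambda>_. True"] by (auto simp: equiv_rels_def equiv_def refl_on_def sym_def trans_def)
  have "(\<integral>r. f r \<partial>clustered) = (\<integral>x. f (?cl x) \<partial>coupling)"
    unfolding clustered_def by (rule integral_distr) measurable
  moreover have "(\<integral>r. f r \<partial>\<rho>) = (\<integral>x. f (fst x) \<partial>coupling)"
  proof -
    have "(\<integral>r. f r \<partial>\<rho>) = (\<integral>r. f r \<partial>distr coupling \<rho> fst)"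
      unfolding coupling_def by (simp only: noises.distr_pair_fst)
    also have "\<dots> = (\<integral>x. f (fst x) \<partial>coupling)"
      by (rule integral_distr) (simp_all add: coupling_def)
    finally show ?thesis .
  qed
  moreover have int: "integrable coupling (\<lambda>x. f (?cl x))" "integrable coupling (\<lambda>x. f (fst x))"
    by (rule coupling.integrable_const_bound[of _ B];
      auto intro!: AE_I2 B cluster_equiv_rels simp: space_coupling)+
  moreover have "\<bar>\<integral>x. f (?cl x) - f (fst x) \<partial>coupling\<bar> \<le> (\<integral>x. e + 2 * B * (\<Sum>p\<in>F. indicator (cut p) x) \<partial>coupling)"
  proof (rule order_trans[OF integral_abs_bound], rule integral_mono)
    fix x assume x: "x \<in> space coupling"
    then have E: "fst x \<in> equiv_rels" "?cl x \<in> equiv_rels"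
      by (auto simp: space_coupling cluster_equiv_rels)
    show "\<bar>f (?cl x) - f (fst x)\<bar> \<le> e + 2 * B * (\<Sum>p\<in>F. indicator (cut p) x)"
    proof (cases "\<forall>p\<in>F. ?cl x p = fst x p")
      case True
      then have "\<bar>f (?cl x) - f (fst x)\<bar> \<le> e" using F(2)[OF E] by simp
      moreover have "0 \<le> 2 * B * (\<Sum>p\<in>F. indicator (cut p) x :: real)"
        using B0 by (intro mult_nonneg_nonneg sum_nonneg) auto
      ultimately show ?thesis by linarith
    next
      case False
      then obtain p where p: "p \<in> F" "x \<in> cut p" using x by (auto simp: cut_def)
      then have "1 \<le> (\<Sum>p\<in>F. indicator (cut p) x :: real)"
        using member_le_sum[of p F "\<lambda>p. indicator (cut p) x :: real"] F(1) by simp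
      then have "2 * B * 1 \<le> 2 * B * (\<Sum>p\<in>F. indicator (cut p) x)"
        using B0 by (intro mult_left_mono) auto
      moreover have "\<bar>f (?cl x) - f (fst x)\<bar> \<le> 2 * B"
        using B[OF E(1)] B[OF E(2)] by linarith
      ultimately show ?thesis using \<open>0 < e\<close> by linarith
    qed
  next
    show "integrable coupling (\<lambda>x. \<bar>f (?cl x) - f (fst x)\<bar>)"
      by (intro integrable_abs Bochner_Integration.integrable_diff int)
    show "integrable coupling (\<lambda>x. e + 2 * B * (\<Sum>p\<in>F. indicator (cut p) x))"
      by (intro Bochner_Integration.integrable_add integrable_mult_right Bochner_Integration.integrable_sum)
        (simp_all add: coupling.emeasure_eq_measure)
  qed
  moreover have "(\<integral>x. e + 2 * B * (\<Sum>p\<in>F. indicator (cut p) x) \<partial>coupling) = e + 2 * B * (\<Sum>p\<in>F. measure coupling (cut p))"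
  proof -
    have ind: "integrable coupling (\<lambda>x. indicator (cut p) x :: real)" for p
      by (simp add: coupling.emeasure_eq_measure)
    then show ?thesis
      by (subst Bochner_Integration.integral_add)
        (simp_all add: coupling.prob_space Bochner_Integration.integrable_sum)
  qed
  ultimately show ?thesis by (simp only: Bochner_Integration.integral_diff)
qed

end

section \<open>Passage to the limit\<close>

lemma AE_shift_rel:
  assumes "IRE \<rho>" "AE r in \<rho>. P r"
  shows "AE r in \<rho>. P (shift_rel g r)"
proof (rule AE_distrD[of "shift_rel g" \<rho> \<rho> P])
  have s: "sets \<rho> = sets Rel_borel" "distr \<rho> \<rho> (shift_rel g) = \<rho>"
    using assms(1) by (auto simp: IRE_def)
  show "shift_rel g \<in> measurable \<rho> \<rho>"
    by (simp add: measurable_cong_sets[OF s(1) s(1)])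
  show "AE r in distr \<rho> \<rho> (shift_rel g). P r"
    by (subst s(2)) (rule assms(2))
qed

theorem proposition3p11:
  fixes \<rho> :: "('g::{group_add,countable} \<times> 'g \<Rightarrow> bool) measure"
  assumes "amenable_IRE \<rho>"
  shows "\<exists>\<rho>s. (\<forall>n. finite_IRE (\<rho>s n)) \<and> weak_limit \<rho>s \<rho>"
proof -
  obtain \<mu> :: "nat \<Rightarrow> ('g \<times> 'g \<Rightarrow> bool) \<Rightarrow> 'g pmf" where
    \<mu>: "\<And>n. \<mu> n \<in> measurable Rel_borel Prob_borel"
    and lim: "AE r in \<rho>. \<forall>g\<in>rel_class r 0.
        (\<lambda>n. l1_dist (translate_pmf (- g) (\<mu> n r)) (\<mu> n (shift_rel (- g) r))) \<longlonglongrightarrow> 0"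
    and IRE: "IRE \<rho>"
    using assms unfolding amenable_IRE_def by blast
  \<comment> \<open>\<open>coupling\<close> is built from \<open>\<rho>\<close> and the noise alone,
    so all stages live on one probability space; \<open>cut\<close> and \<open>clustered\<close>
    acquire the index n.\<close>
  interpret random_clustering \<rho> "\<mu> n" for n
    by unfold_locales (simp_all add: IRE \<mu>)
  have cut0: "(\<lambda>n. measure coupling (cut n (v, w))) \<longlonglongrightarrow> 0" for v w
  proof -
    \<comment> \<open>The hypothesis concerns the class of the identity. Applied to the relation
      shifted by \<open>- v\<close>, it controls the pair consisting of 0 and
      \<open>- v + w\<close>, which is the pair (v, w) of r.\<close>
    have "AE r in \<rho>. (\<lambda>n. emeasure noises (Pair r -` cut n (v, w))) \<longlonglongrightarrow> 0"
      using AE_shift_rel[OF IRE lim, of "- v"]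
    proof (rule AE_mp, intro AE_I2 impI)
      fix r assume r: "r \<in> space \<rho>"
      define s where "s = shift_rel (- v) r"
      define d where "d n = l1_dist (translate_pmf (- (- v + w)) (\<mu> n s)) (\<mu> n (shift_rel (- (- v + w)) s))" for n
      have d0: "0 \<le> d n" for n
        by (simp add: d_def Metric_space.nonneg[OF Metric_space_l1_dist])
      assume "\<forall>g\<in>rel_class (shift_rel (- v) r) 0. (\<lambda>n. l1_dist (translate_pmf (- g) (\<mu> n (shift_rel (- v) r)))
          (\<mu> n (shift_rel (- g) (shift_rel (- v) r)))) \<longlonglongrightarrow> 0"
      then have d: "d \<longlonglongrightarrow> 0" if "s (0, - v + w)"
        using that unfolding d_def[abs_def] s_def[symmetric] rel_class_def by blast
      have le: "emeasure noises (Pair r -` cut n (v, w)) \<le>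
          (if s (0, - v + w) then ennreal ((3/4) ^ N + N * d n) else 0)" for n N
        unfolding s_def d_def using r by (intro emeasure_cut_section_le) simp
      show "(\<lambda>n. emeasure noises (Pair r -` cut n (v, w))) \<longlonglongrightarrow> 0"
      proof (cases "s (0, - v + w)")
        case True
        have "(\<lambda>n. noises.prob (Pair r -` cut n (v, w))) \<longlonglongrightarrow> 0"
        proof (rule LIMSEQ_I)
          fix e :: real assume "0 < e"
          \<comment> \<open>N is chosen before n: it makes the probability of no settled round
            small, and then N times the l1-distance tends to 0.\<close>
          then obtain N where N: "(3/4 :: real) ^ N < e / 2"
            using real_arch_pow_inv[of "e/2" "3/4"] by auto
          have "(\<lambda>n. N * d n) \<longlonglongrightarrow> 0"
            using tendsto_mult_left[OF d[OF True], of "real N"] by simp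
          then obtain n0 where n0: "\<forall>n\<ge>n0. norm (N * d n - 0) < e / 2"
            using LIMSEQ_D[of "\<lambda>n. N * d n" 0 "e/2"] half_gt_zero[OF \<open>0 < e\<close>] by blast
          have le': "noises.prob (Pair r -` cut n (v, w)) \<le> (3/4) ^ N + N * d n" for n
            using le[of n N] True
            by (simp add: noises.emeasure_eq_measure d0 del: ennreal_plus)
          have "noises.prob (Pair r -` cut n (v, w)) < e" if "n \<ge> n0" for n
            using N le'[of n] n0[rule_format, OF that] unfolding diff_0_right real_norm_def by linarith
          then show "\<exists>n0. \<forall>n\<ge>n0. norm (noises.prob (Pair r -` cut n (v, w)) - 0) < e"
            by auto
        qed
        from tendsto_ennrealI[OF this] show ?thesis
          by (simp add: noises.emeasure_eq_measure)
      qed (use le in simp)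
    qed
    \<comment> \<open>The rate of convergence may depend on r; the constant 1 dominates, as these
      are probabilities.\<close>
    then have "(\<lambda>n. \<integral>\<^sup>+r. emeasure noises (Pair r -` cut n (v, w)) \<partial>\<rho>) \<longlonglongrightarrow> (\<integral>\<^sup>+r. 0 \<partial>\<rho>)"
      by (intro nn_integral_dominated_convergence[where w = "\<lambda>_. 1"])
        (auto simp: less_top[symmetric] noises.emeasure_le_1)
    then have "(\<lambda>n. ennreal (measure coupling (cut n (v, w)))) \<longlonglongrightarrow> ennreal 0"
      by (simp add: emeasure_cut[symmetric] coupling.emeasure_eq_measure)
    then show ?thesis
      by (subst (asm) tendsto_ennreal_iff) auto
  qed
  have "weak_limit clustered \<rho>"
    unfolding weak_limit_def
  proof (intro allI impI)
    fix f :: "('g \<times> 'g \<Rightarrow> bool) \<Rightarrow> real" assume f: "continuous_on equiv_rels f"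
    obtain B where B: "\<And>r. r \<in> equiv_rels \<Longrightarrow> \<bar>f r\<bar> \<le> B"
      using compact_imp_bounded[OF compact_continuous_image[OF f compact_equiv_rels]]
      by (auto simp: bounded_iff)
    show "(\<lambda>n. \<integral>r. f r \<partial>clustered n) \<longlonglongrightarrow> (\<integral>r. f r \<partial>\<rho>)"
    proof (rule LIMSEQ_I)
      fix e :: real assume "0 < e"
      then obtain F where F: "finite F"
        "\<And>r s. r \<in> equiv_rels \<Longrightarrow> s \<in> equiv_rels \<Longrightarrow> (\<forall>p\<in>F. s p = r p) \<Longrightarrow> \<bar>f s - f r\<bar> < e/2"
        using continuous_on_equiv_rels_depends_finitely[OF f, of "e/2"] by auto
      have "(\<lambda>n. 2 * B * (\<Sum>p\<in>F. measure coupling (cut n p))) \<longlonglongrightarrow> 2 * B * (\<Sum>p\<in>F. 0)"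
        by (intro tendsto_intros) (metis cut0 surj_pair)
      then have "(\<lambda>n. 2 * B * (\<Sum>p\<in>F. measure coupling (cut n p))) \<longlonglongrightarrow> 0"
        by simp
      then obtain n0 where n0: "\<forall>n\<ge>n0. norm (2 * B * (\<Sum>p\<in>F. measure coupling (cut n p)) - 0) < e / 2"
        using LIMSEQ_D half_gt_zero[OF \<open>0 < e\<close>] by blast
      have le: "\<bar>(\<integral>r. f r \<partial>clustered n) - (\<integral>r. f r \<partial>\<rho>)\<bar>
          \<le> e/2 + 2 * B * (\<Sum>p\<in>F. measure coupling (cut n p))" for n
        using half_gt_zero[OF \<open>0 < e\<close>] by (intro integral_clustered f F B)
      have "norm ((\<integral>r. f r \<partial>clustered n) - (\<integral>r. f r \<partial>\<rho>)) < e" if "n \<ge> n0" for n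
        using le[of n] n0[rule_format, OF that] unfolding diff_0_right real_norm_def by linarith
      then show "\<exists>n0. \<forall>n\<ge>n0. norm ((\<integral>r. f r \<partial>clustered n) - (\<integral>r. f r \<partial>\<rho>)) < e"
        by blast
    qed
  qed
  then show ?thesis
    using finite_IRE_clustered by (intro exI[of _ clustered] conjI allI)
qed

end
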